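(* Let $p$ be a prime number and $k \geq 1$ an integer. Let $M=(m_{ij})_{0\le i,j<p^k}$ be a difference matrix in $D(p^k,p^k,\mathbb{Z}_p^k)$, and let $(a(n))_{n\ge 0}$ be the Rudin--Shapiro sequence associated to $M$ (with $a(0)\in\mathbb{Z}_p^k$ arbitrary). For $0\le i<j$ let $\delta(i,j)=0$ if $a(i)=a(j)$ and $\delta(i,j)=1$ otherwise. Then, for $0 \leq r_1 < r_2$, as $N \to \infty$, $$\sum_{n<N}\delta(n+r_1,n+r_2)=N\left(1-\frac{1}{p^k}\right)+O_{p,k}\left((r_2-r_1)\log\frac{N}{r_2-r_1}+r_2\right),$$ where the implied constant depends only on $p$ and $k$ (and not on $r_1,r_2$, which are allowed to depend on $N$).
   Context: $\mathbb{Z}_p=\mathbb{Z}/p\mathbb{Z}$ and $\mathbb{Z}_p^k$ is the $k$-fold product group. For a finite abelian group $G$, a difference matrix $D=(d_{ij})$ of size $r\times c$ with entries in $G$ is a matrix such that for all $i\neq j$ in $\{1,\dots,c\}$, the multiset $\{d_{li}-d_{lj}:1\le l\le r\}$ contains every element of $G$ equally often; $D(r,c,G)$ denotes the set of such matrices. Given $M=(m_{ij})_{0\le i,j<p^k}\in D(p^k,p^k,\mathbb{Z}_p^k)$, define $g:\mathbb{Z}\times\mathbb{Z}\to\mathbb{Z}_p^k$ by $g(j,n)=m_{n \bmod p^k,\, j \bmod p^k}$. The Rudin--Shapiro sequence associated to $M$ is the sequence $(a(n))_{n\ge0}$ with values in $\mathbb{Z}_p^k$, with $a(0)$ fixed arbitrarily,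 defined by $a(p^kn+j)=a(n)+g(j,n)$ for $0\le j\le p^k-1$, $n\ge 0$, $(j,n)\neq(0,0)$.
   Formalization: The logarithm log(N/(r_2-r_1)) is read as max(0, log(N/(r_2-r_1))), which changes the error term only when N < r_2-r_1; there the literal term can vanish (e.g. r_1=0, r_2 close to eN) and the claim fails. *)

theory Defs
  imports Complex_Main "HOL-Computational_Algebra.Primes" "HOL-Algebra.Product_Groups"
begin

text \<open>HOL-Algebra groups are written multiplicatively, so the additive difference $x - y$
  in $G$ reads \<open>x \<otimes>\<^bsub>G\<^esub> inv\<^bsub>G\<^esub> y\<close> below. Elements of the group \<open>Zp_power p k\<close>
  are extensional functions on \<open>{..<k}\<close>, so equality of elements is plain equality.\<close>

definition Zp_power :: "nat \<Rightarrow> nat \<Rightarrow> (nat \<Rightarrow> int) monoid" where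
  "Zp_power p k = product_group {..<k} (\<lambda>_. integer_mod_group p)"

text \<open>Matrices are functions of a row index and a column index, both counted from 0; entries
  outside the \<open>r \<times> c\<close> range are unconstrained and irrelevant.\<close>

definition difference_matrices ::
    "nat \<Rightarrow> nat \<Rightarrow> ('a, 'b) monoid_scheme \<Rightarrow> (nat \<Rightarrow> nat \<Rightarrow> 'a) set" where
  "difference_matrices r c G =
     {d. (\<forall>l<r. \<forall>i<c. d l i \<in> carrier G) \<and>
         (\<forall>i<c. \<forall>j<c. i \<noteq> j \<longrightarrow>
            (\<exists>m. \<forall>x\<in>carrier G.
               count {# d l i \<otimes>\<^bsub>G\<^esub> inv\<^bsub>G\<^esub> (d l j). l \<in># mset_set {..<r} #} x = m))}"

definition rs_g :: "nat \<Rightarrow> (nat \<Rightarrow> nat \<Rightarrow> 'a) \<Rightarrow> int \<Rightarrow> int \<Rightarrow> 'a" where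
  "rs_g q M j n = M (nat (n mod int q)) (nat (j mod int q))"

text \<open>The initial value \<open>a 0\<close> is left arbitrary in the carrier; \<open>M\<close> and \<open>a 0\<close> determine \<open>a\<close>.\<close>

definition rudin_shapiro_seq ::
    "nat \<Rightarrow> nat \<Rightarrow> (nat \<Rightarrow> nat \<Rightarrow> nat \<Rightarrow> int) \<Rightarrow> (nat \<Rightarrow> nat \<Rightarrow> int) \<Rightarrow> bool" where
  "rudin_shapiro_seq p k M a \<longleftrightarrow>
     (\<forall>n. a n \<in> carrier (Zp_power p k)) \<and>
     (\<forall>n j. j < p ^ k \<longrightarrow> (j, n) \<noteq> (0, 0) \<longrightarrow>
        a (p ^ k * n + j) = a n \<otimes>\<^bsub>Zp_power p k\<^esub> rs_g (p ^ k) M (int j) (int n))"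

definition \<delta> :: "(nat \<Rightarrow> 'a) \<Rightarrow> nat \<Rightarrow> nat \<Rightarrow> nat" where
  "\<delta> a i j = (if a i = a j then 0 else 1)"

end

theory Submission
  imports Defs
begin

text \<open>Let \<open>q = p ^ k\<close> and \<open>r = r2 - r1\<close>, and classify \<open>n\<close> by the highest base-\<open>q\<close> digit position \<open>e\<close>
  at which \<open>n\<close> and \<open>n + r\<close> differ. Above \<open>e\<close> the digits agree, so unfolding the recursion shows that
  \<open>a (n + r) - a n\<close> is the difference of two distinct columns of \<open>M\<close> in the row given by digit
  \<open>e + 1\<close> of \<open>n\<close>, plus a term depending only on the digits up to \<open>e\<close>. Letting digit \<open>e + 1\<close> vary
  freely makes this difference take every value exactly once, so only incomplete blocks contribute
  an error. There are at most \<open>q * r\<close> residues modulo \<open>q ^ (e + 1)\<close> for each \<open>e\<close>, and only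
  \<open>O(1 + log (N / r))\<close> positions \<open>e\<close> matter.\<close>

section \<open>Block sums, carries and the number of levels\<close>

lemma abs_sum_le_of_block_sums_zero:
  fixes \<psi> :: "nat \<Rightarrow> real"
  assumes zero: "\<And>h. h \<ge> 1 \<Longrightarrow> (\<Sum>l<q. \<psi> (q * h + l)) = 0"
    and bound: "\<And>w. \<bar>\<psi> w\<bar> \<le> B" and q: "q > 0"
  shows "\<bar>\<Sum>w<W. \<psi> w\<bar> \<le> 2 * real q * B"
proof -
  have B: "B \<ge> 0" using bound[of 0] by linarith
  have short: "\<bar>sum \<psi> S\<bar> \<le> real q * B" if "card S \<le> q" for S
  proof -
    have "\<bar>sum \<psi> S\<bar> \<le> (\<Sum>w\<in>S. \<bar>\<psi> w\<bar>)" by (rule sum_abs)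
    also have "\<dots> \<le> real (card S) * B" by (rule sum_bounded_above) (use bound in auto)
    also have "\<dots> \<le> real q * B" using that B by (intro mult_right_mono) auto
    finally show ?thesis .
  qed
  \<comment> \<open>All blocks from index 1 on cancel, so a prefix made of whole blocks reduces to
    block 0. Block 0 and the incomplete last block account for the factor 2.\<close>
  have blocks: "(\<Sum>w<q * Suc H. \<psi> w) = (\<Sum>w<q. \<psi> w)" for H
  proof (induction H)
    case (Suc H)
    have "(\<Sum>w<q * Suc (Suc H). \<psi> w) = (\<Sum>w<q * Suc H. \<psi> w) + (\<Sum>w=q * Suc H..<q * Suc H + q. \<psi> w)"
      using sum.atLeastLessThan_concat[of 0 "q * Suc H" "q * Suc H + q" \<psi>]
      by (simp add: lessThan_atLeast0 add.commute)
    also have "(\<Sum>w=q * Suc H..<q * Suc H + q. \<psi> w) = (\<Sum>l<q. \<psi> (q * Suc H + l))"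
      using sum.shift_bounds_nat_ivl[of \<psi> 0 "q * Suc H" q]
      by (simp add: lessThan_atLeast0 add.commute)
    finally show ?case using Suc zero[of "Suc H"] by simp
  qed simp
  show ?thesis
  proof (cases "W div q")
    case 0
    then have "W \<le> q" using q by (auto simp: div_eq_0_iff)
    then show ?thesis using short[of "{..<W}"] B by (auto simp: mult.assoc intro: order_trans)
  next
    case (Suc H)
    have le: "q * Suc H \<le> W" using Suc by (metis mult.commute div_times_less_eq_dividend)
    have "W < q * Suc H + q" using Suc q
      by (metis add.commute mult.commute mult_Suc dividend_less_div_times)
    then have "card {q * Suc H..<W} \<le> q" by simp
    then have "\<bar>sum \<psi> {q * Suc H..<W}\<bar> \<le> real q * B" by (rule short)
    moreover have "\<bar>sum \<psi> {..<q * Suc H}\<bar> \<le> real q * B" unfolding blocks by (rule short) simp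
    moreover have "sum \<psi> {..<W} = sum \<psi> {..<q * Suc H} + sum \<psi> {q * Suc H..<W}"
      using le by (simp add: lessThan_atLeast0 sum.atLeastLessThan_concat)
    ultimately show ?thesis by linarith
  qed
qed

text \<open>The quotient changes only if adding \<open>r\<close> carries past \<open>P\<close>.
  Subtraction truncates, so the bound is vacuous for \<open>r \<ge> P\<close>.\<close>

lemma mod_ge_if_div_add_neq:
  fixes u r P :: nat
  assumes "u div P \<noteq> (u + r) div P" and "P > 0"
  shows "P - r \<le> u mod P"
proof (rule ccontr)
  assume "\<not> P - r \<le> u mod P"
  then have "u mod P + r < P" by linarith
  moreover have "u + r = P * (u div P) + (u mod P + r)" by simp
  ultimately have "(u + r) div P = u div P"
    using assms(2) by (metis div_mult_self4 div_less add_0_right less_numeral_extra(3))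
  then show False using assms(1) by simp
qed

text \<open>There are \<open>q\<close> choices for \<open>u div P\<close>, each leaving at most
  \<open>r\<close> choices for \<open>u mod P\<close>. The bound is free of \<open>P\<close>, later
  \<open>q ^ e\<close>, which makes the contribution of every level linear in
  \<open>r\<close>.\<close>

lemma card_div_add_neq_le:
  fixes P q r :: nat
  assumes "P > 0"
  shows "card {u. u < P * q \<and> u div P \<noteq> (u + r) div P} \<le> q * r"
proof -
  have "{u. u < P * q \<and> u div P \<noteq> (u + r) div P} \<subseteq> (\<lambda>(d, v). P * d + v) ` ({..<q} \<times> {P - r..<P})"
  proof
    fix u assume u: "u \<in> {u. u < P * q \<and> u div P \<noteq> (u + r) div P}"
    then have "u div P < q" by (simp add: less_mult_imp_div_less mult.commute)
    moreover have "P - r \<le> u mod P" "u mod P < P"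
      using u assms mod_ge_if_div_add_neq by auto
    ultimately show "u \<in> (\<lambda>(d, v). P * d + v) ` ({..<q} \<times> {P - r..<P})"
      by (intro image_eqI[of _ _ "(u div P, u mod P)"]) auto
  qed
  then have "card {u. u < P * q \<and> u div P \<noteq> (u + r) div P} \<le> card ({..<q} \<times> {P - r..<P})"
    by (rule surj_card_le[rotated]) simp
  also have "\<dots> \<le> q * r" by (simp only: card_cartesian_product card_lessThan card_atLeastLessThan) (intro mult_left_mono; linarith)
  finally show ?thesis .
qed

text \<open>The counted positions start near the base-\<open>q\<close> logarithm of \<open>r\<close>
  and end near that of \<open>N\<close>, so their number is governed by the logarithm of
  \<open>N / r\<close>. The \<open>max\<close> covers \<open>N < r\<close>.\<close>

lemma card_level_set_le:
  fixes q r N E :: nat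
  assumes q: "q \<ge> 2" and r: "r \<ge> 1" and E: "\<And>e. e < E \<Longrightarrow> q ^ e < N"
  shows "real (card {e. e < E \<and> r < q ^ Suc e}) \<le> 2 + 2 * max 0 (ln (real N / real r))"
proof (cases "\<exists>e<E. r < q ^ Suc e")
  case False
  then have "{e. e < E \<and> r < q ^ Suc e} = {}" by auto
  then show ?thesis by (metis card.empty of_nat_0 max.cobounded1 add_nonneg_nonneg mult_nonneg_nonneg zero_le_numeral zero_le_one)
next
  case True
  define e0 where "e0 = (LEAST e. r < q ^ Suc e)"
  from True obtain e1 where e1: "e1 < E" "r < q ^ Suc e1" by auto
  have e0: "r < q ^ Suc e0" "e0 \<le> e1"
    unfolding e0_def using e1(2) by (auto intro: LeastI Least_le)
  have "{e. e < E \<and> r < q ^ Suc e} \<subseteq> {e0..<E}"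
    unfolding e0_def by (auto intro: Least_le)
  then have card: "card {e. e < E \<and> r < q ^ Suc e} \<le> E - e0"
    using card_mono[of "{e0..<E}"] by simp
  define m where "m = E - 1 - e0"
  have E1: "E - 1 = m + e0" using e0 e1 by (simp add: m_def)
  have bound: "q ^ m * q ^ e0 < N" using E[of "E - 1"] e1 E1 by (simp add: power_add)
  have "real m \<le> 1 + 2 * max 0 (ln (real N / real r))"
  proof (cases m)
    case (Suc m')
    \<comment> \<open>Here \<open>m = Suc m'\<close>, and the surplus factor \<open>q\<close> turns
      \<open>q ^ e0\<close> into \<open>q ^ Suc e0\<close>, which exceeds \<open>r\<close>.\<close>
    have "q ^ m' * r \<le> q ^ m' * q ^ Suc e0" using e0(1) by simp
    also have "\<dots> < N" using bound Suc by (simp add: ac_simps)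
    finally have "real (q ^ m' * r) < real N" by (simp only: of_nat_less_iff)
    then have "real q ^ m' < real N / real r" using r by (simp add: field_simps)
    moreover have "0 < real q ^ m'" using q by simp
    ultimately have "ln (real q ^ m') \<le> ln (real N / real r)" by (intro ln_mono) linarith+
    then have "real m' * ln (real q) \<le> ln (real N / real r)" using q by (simp add: ln_realpow)
    \<comment> \<open>This lower bound, from \<open>q \<ge> 2\<close>, is the source of the factor 2
      before the logarithm.\<close>
    moreover have "1 / 2 \<le> ln (real q)"
    proof -
      have "ln (1 / real q) \<le> 1 / real q - 1" using q by (intro ln_le_minus_one) simp
      moreover have "1 / real q \<le> 1 / 2" using q by (simp add: field_simps)
      moreover have "ln (1 / real q) = - ln (real q)" using q by (simp add: ln_div)
      ultimately show ?thesis by linarith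
    qed
    then have "real m' * (1 / 2) \<le> real m' * ln (real q)" by (intro mult_left_mono) auto
    ultimately show ?thesis using Suc by simp
  qed simp
  then show ?thesis using card by (simp add: m_def)
qed

text \<open>In \<open>block_sum_zero\<close> this separates \<open>x\<close> and \<open>y\<close>,
  entries of the row that varies, from \<open>s\<close> and \<open>t\<close>, which stay
  fixed.\<close>

lemma (in comm_group) mult_eq_iff_div_eq:
  assumes "x \<in> carrier G" "y \<in> carrier G" "s \<in> carrier G" "t \<in> carrier G"
  shows "x \<otimes> s = y \<otimes> t \<longleftrightarrow> x \<otimes> inv y = t \<otimes> inv s"
proof -
  have "x \<otimes> inv y = t \<otimes> inv s \<longleftrightarrow> x = (t \<otimes> inv s) \<otimes> y"
    using inv_solve_right[of "t \<otimes> inv s" x y] assms by auto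
  also have "(t \<otimes> inv s) \<otimes> y = (y \<otimes> t) \<otimes> inv s"
    using assms by (simp add: m_ac)
  also have "x = (y \<otimes> t) \<otimes> inv s \<longleftrightarrow> y \<otimes> t = x \<otimes> s"
    using assms by (intro inv_solve_right) auto
  finally show ?thesis by auto
qed

section \<open>The recursion over an arbitrary abelian group of order \<open>q\<close>\<close>

locale difference_matrix_sequence = comm_group G for G (structure) +
  fixes q :: nat and M :: "nat \<Rightarrow> nat \<Rightarrow> 'a" and a :: "nat \<Rightarrow> 'a"
  assumes finite_carrier: "finite (carrier G)"
    and card_carrier: "card (carrier G) = q"
    and q_ge_2: "q \<ge> 2"
    and matrix: "M \<in> difference_matrices q q G"
    and a_closed [simp]: "\<And>n. a n \<in> carrier G"
    and a_rec: "\<And>n j. j < q \<Longrightarrow> (j, n) \<noteq> (0, 0) \<Longrightarrow> a (q * n + j) = a n \<otimes> M (n mod q) j"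
begin

lemma M_closed [simp]: "l < q \<Longrightarrow> i < q \<Longrightarrow> M l i \<in> carrier G"
  using matrix by (simp add: difference_matrices_def)

text \<open>The \<open>q\<close> rows split into \<open>q\<close> fibres, one per group element, all
  of the same size \<open>m\<close>; so \<open>q = q * m\<close> and \<open>m = 1\<close>.\<close>

lemma unique_row:
  assumes "i < q" "j < q" "i \<noteq> j" "x \<in> carrier G"
  shows "card {l. l < q \<and> M l i \<otimes> inv (M l j) = x} = 1"
proof -
  define S where "S y = {l. l < q \<and> M l i \<otimes> inv (M l j) = y}" for y
  have "\<exists>m. \<forall>y\<in>carrier G. count {# M l i \<otimes> inv (M l j). l \<in># mset_set {..<q} #} y = m"
    using matrix assms(1-3) by (simp add: difference_matrices_def)
  then obtain m where m: "\<And>y. y \<in> carrier G \<Longrightarrow>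
      count {# M l i \<otimes> inv (M l j). l \<in># mset_set {..<q} #} y = m"
    by auto
  have S: "card (S y) = m" if "y \<in> carrier G" for y
  proof -
    have "m = (\<Sum>l\<in>S y. count (mset_set {..<q}) l)"
      using m[OF that] by (simp add: count_image_mset' S_def eq_commute[of y])
    also have "\<dots> = (\<Sum>l\<in>S y. 1)" by (intro sum.cong) (auto simp: S_def)
    finally show ?thesis by simp
  qed
  have "q = card (\<Union>y\<in>carrier G. S y)"
  proof -
    have "(\<Union>y\<in>carrier G. S y) = {..<q}" using assms by (auto simp: S_def)
    then show ?thesis by simp
  qed
  also have "\<dots> = (\<Sum>y\<in>carrier G. card (S y))"
    by (rule card_UN_disjoint) (auto simp: finite_carrier S_def)
  also have "\<dots> = q * m" by (simp add: S card_carrier)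
  finally have "m = 1" using q_ge_2 by simp
  then show ?thesis using S[OF assms(4)] by (simp add: S_def)
qed

text \<open>The restriction to \<open>w \<ge> 1\<close> avoids the exceptional case \<open>(j, n) = (0, 0)\<close> of the recursion.\<close>

lemma digit_expansion:
  assumes "u < q ^ Suc e"
  shows "\<exists>s\<in>carrier G. \<forall>w\<ge>1. a (q ^ Suc e * w + u) = a w \<otimes> M (w mod q) (u div q ^ e) \<otimes> s"
  using assms
proof (induction e arbitrary: u)
  case 0
  then show ?case using q_ge_2 a_rec by (intro bexI[of _ \<one>]) auto
next
  case (Suc e)
  \<comment> \<open>Stripping the lowest digit \<open>j\<close> keeps the top digit of
    \<open>u\<close>. The factor contributed by \<open>j\<close> involves only the lowest digit of
    \<open>u'\<close>, not \<open>w\<close>, so \<open>s\<close> can absorb it.\<close>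
  define u' j where "u' = u div q" and "j = u mod q"
  have u: "u = q * u' + j" and j: "j < q" using q_ge_2 by (auto simp: u'_def j_def)
  have u': "u' < q ^ Suc e"
    using Suc.prems by (simp add: u'_def less_mult_imp_div_less mult.commute)
  obtain s where s: "s \<in> carrier G"
    "\<And>w. w \<ge> 1 \<Longrightarrow> a (q ^ Suc e * w + u') = a w \<otimes> M (w mod q) (u' div q ^ e) \<otimes> s"
    using Suc.IH[OF u'] by blast
  have div: "u' div q ^ e = u div q ^ Suc e" by (simp add: u'_def div_mult2_eq)
  have lt: "u div q ^ Suc e < q" using Suc.prems by (simp add: less_mult_imp_div_less mult.commute)
  have mod: "u' mod q < q" using q_ge_2 by simp
  show ?case
  proof (intro bexI[of _ "s \<otimes> M (u' mod q) j"] allI impI)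
    fix w :: nat assume w: "w \<ge> 1"
    have wq: "w mod q < q" using q_ge_2 by simp
    have eq: "q ^ Suc (Suc e) * w + u = q * (q ^ Suc e * w + u') + j"
      by (simp add: u algebra_simps)
    have "q ^ Suc e * w + u' \<noteq> 0" using w q_ge_2 by simp
    then have "a (q ^ Suc (Suc e) * w + u)
        = a (q ^ Suc e * w + u') \<otimes> M ((q ^ Suc e * w + u') mod q) j"
      unfolding eq by (intro a_rec j) auto
    also have "(q ^ Suc e * w + u') mod q = u' mod q"
      by (simp add: mult.assoc)
    finally show "a (q ^ Suc (Suc e) * w + u)
        = a w \<otimes> M (w mod q) (u div q ^ Suc e) \<otimes> (s \<otimes> M (u' mod q) j)"
      using s w j mod lt wq by (simp add: div m_assoc)
  qed (use s j mod in simp)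
qed

text \<open>A multiple of the indicator of \<open>a n = a (n + r)\<close>, centred so that its mean
  vanishes if this equality holds with frequency \<open>1 / q\<close>.\<close>

definition \<phi> :: "nat \<Rightarrow> nat \<Rightarrow> real" where
  "\<phi> r n = (if a n = a (n + r) then real q else 0) - 1"

lemma abs_\<phi>_le: "\<bar>\<phi> r n\<bar> \<le> real q"
  using q_ge_2 by (simp add: \<phi>_def)

text \<open>No carry reaches \<open>w = q * h + l\<close>, so \<open>a w\<close> cancels and
  equality becomes a condition on two distinct columns in row \<open>l\<close>. Exactly one
  \<open>l\<close> meets it: one term \<open>q - 1\<close> balances \<open>q - 1\<close> terms equal
  to \<open>-1\<close>. Because \<open>h \<ge> 1\<close>, even \<open>l = 0\<close> has
  \<open>w \<ge> 1\<close>.\<close>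

lemma block_sum_zero:
  assumes u: "u + r < q ^ Suc e" "u div q ^ e \<noteq> (u + r) div q ^ e" and h: "h \<ge> 1"
  shows "(\<Sum>l<q. \<phi> r (q ^ Suc e * (q * h + l) + u)) = 0"
proof -
  define i j where "i = u div q ^ e" and "j = (u + r) div q ^ e"
  have ij: "i < q" "j < q" "i \<noteq> j"
    using u by (auto simp: i_def j_def less_mult_imp_div_less mult.commute)
  obtain s where s: "s \<in> carrier G"
    "\<And>w. w \<ge> 1 \<Longrightarrow> a (q ^ Suc e * w + u) = a w \<otimes> M (w mod q) i \<otimes> s"
    using digit_expansion[of u e] u unfolding i_def by auto
  obtain t where t: "t \<in> carrier G"
    "\<And>w. w \<ge> 1 \<Longrightarrow> a (q ^ Suc e * w + (u + r)) = a w \<otimes> M (w mod q) j \<otimes> t"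
    using digit_expansion[of "u + r" e] u unfolding j_def by auto
  have iff: "a (q ^ Suc e * (q * h + l) + u) = a (q ^ Suc e * (q * h + l) + u + r)
      \<longleftrightarrow> M l i \<otimes> inv (M l j) = t \<otimes> inv s" if l: "l < q" for l
  proof -
    have "q * h \<ge> 1" using h q_ge_2 by (simp add: Suc_le_eq)
    then have w: "q * h + l \<ge> 1" "(q * h + l) mod q = l" using l by (simp_all only: trans_le_add1) simp
    have "a (q ^ Suc e * (q * h + l) + u) = a (q ^ Suc e * (q * h + l) + u + r)
      \<longleftrightarrow> M l i \<otimes> s = M l j \<otimes> t"
      using s(2)[OF w(1)] t(2)[OF w(1)] w(2) s(1) t(1) l ij by (simp add: m_assoc add.assoc)
    also have "\<dots> \<longleftrightarrow> M l i \<otimes> inv (M l j) = t \<otimes> inv s"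
      using s(1) t(1) l ij
      by (intro mult_eq_iff_div_eq) auto
    finally show ?thesis .
  qed
  have "(\<Sum>l<q. \<phi> r (q ^ Suc e * (q * h + l) + u))
      = (\<Sum>l<q. (if M l i \<otimes> inv (M l j) = t \<otimes> inv s then real q else 0) - 1)"
    by (intro sum.cong refl) (use iff in \<open>auto simp: \<phi>_def\<close>)
  also have "\<dots> = real (card {l. l < q \<and> M l i \<otimes> inv (M l j) = t \<otimes> inv s}) * real q - real q"
    by (simp add: sum_subtractf sum.If_cases Int_def conj_commute)
  also have "\<dots> = 0" using unique_row[OF ij, of "t \<otimes> inv s"] s t by simp
  finally show ?thesis .
qed

section \<open>Splitting by the highest digit position where \<open>n\<close> and
  \<open>n + r\<close> differ\<close>

definition level :: "nat \<Rightarrow> nat \<Rightarrow> nat \<Rightarrow> bool" where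
  "level r e n \<longleftrightarrow> n div q ^ Suc e = (n + r) div q ^ Suc e \<and> n div q ^ e \<noteq> (n + r) div q ^ e"

text \<open>Makes level \<open>e\<close> a union of residue classes modulo \<open>q ^ Suc e\<close>;
  the first condition says that no carry leaves the lowest \<open>e + 1\<close> digits.\<close>

lemma level_iff:
  assumes "u < q ^ Suc e"
  shows "level r e (q ^ Suc e * w + u) \<longleftrightarrow> u + r < q ^ Suc e \<and> u div q ^ e \<noteq> (u + r) div q ^ e"
proof -
  have pos: "q ^ Suc e > 0" "q ^ e > 0" using q_ge_2 by auto
  have 1: "(q ^ Suc e * w + v) div q ^ Suc e = w + v div q ^ Suc e" for v
    using pos by simp
  have 2: "(q ^ Suc e * w + v) div q ^ e = q * w + v div q ^ e" for v
    using pos(2) div_mult_self4[of "q ^ e" "q * w" v] by (simp add: ac_simps)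
  have 3: "v div q ^ Suc e = 0 \<longleftrightarrow> v < q ^ Suc e" for v
    using pos(1) by (simp only: div_eq_0_iff) auto
  show ?thesis
    unfolding level_def add.assoc 1 2 using assms 3[of u] 3[of "u + r"] by (auto simp del: power_Suc)
qed

text \<open>Along each admissible residue class modulo \<open>q ^ Suc e\<close> the blocks of length
  \<open>q\<close> cancel, leaving at most \<open>2 * q * q\<close>; there are at most
  \<open>q * r\<close> such classes.\<close>

lemma level_sum_le:
  "\<bar>\<Sum>n | n < N \<and> level r e n. \<phi> r n\<bar> \<le> real (q * r) * (2 * real q * real q)"
proof -
  define Q where "Q = q ^ Suc e"
  have Q: "Q > 0" using q_ge_2 by (simp add: Q_def)
  define A where "A = {u. u < Q \<and> u + r < Q \<and> u div q ^ e \<noteq> (u + r) div q ^ e}"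
  define T where "T = {n. n < N \<and> level r e n}"
  have lev: "level r e (Q * w + u) \<longleftrightarrow> u \<in> A" if "u < Q" for u w
    using level_iff[of u e r w] that by (simp add: A_def Q_def)
  have finA: "finite A" by (rule finite_subset[of _ "{..<Q}"]) (auto simp: A_def)
  have "card A \<le> card {u. u < q ^ e * q \<and> u div q ^ e \<noteq> (u + r) div q ^ e}"
    by (intro card_mono) (auto simp: A_def Q_def mult.commute)
  also have "\<dots> \<le> q * r" using q_ge_2 by (intro card_div_add_neq_le) auto
  finally have cardA: "card A \<le> q * r" .
  have fibre: "\<bar>\<Sum>n | n \<in> T \<and> n mod Q = u. \<phi> r n\<bar> \<le> 2 * real q * real q" if u: "u \<in> A" for u
  proof -
    have uQ: "u < Q" using u by (simp add: A_def)
    \<comment> \<open>\<open>W\<close> counts the \<open>w\<close> with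
      \<open>Q * w + u < N\<close>; the case distinction keeps \<open>N - 1 - u\<close> from
      truncating.\<close>
    define W where "W = (if u < N then Suc ((N - 1 - u) div Q) else 0)"
    have W: "w < W \<longleftrightarrow> Q * w + u < N" for w
      using Q by (auto simp: W_def less_Suc_eq_le less_eq_div_iff_mult_less_eq mult.commute)
    have "{n. n \<in> T \<and> n mod Q = u} = (\<lambda>w. Q * w + u) ` {..<W}"
    proof (rule Set.set_eqI, rule iffI)
      fix n assume n: "n \<in> {n. n \<in> T \<and> n mod Q = u}"
      then have "n = Q * (n div Q) + u" by auto
      with n show "n \<in> (\<lambda>w. Q * w + u) ` {..<W}"
        by (intro image_eqI[of _ _ "n div Q"]) (auto simp: W T_def)
    qed (use uQ u lev[OF uQ] W in \<open>auto simp: T_def\<close>)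
    moreover have "inj_on (\<lambda>w. Q * w + u) {..<W}" using Q by (auto simp: inj_on_def)
    ultimately have "(\<Sum>n | n \<in> T \<and> n mod Q = u. \<phi> r n) = (\<Sum>w<W. \<phi> r (Q * w + u))"
      by (simp add: sum.reindex)
    also have "\<bar>\<dots>\<bar> \<le> 2 * real q * real q"
    proof (rule abs_sum_le_of_block_sums_zero)
      show "(\<Sum>l<q. \<phi> r (Q * (q * h + l) + u)) = 0" if "h \<ge> 1" for h
        unfolding Q_def using u that by (intro block_sum_zero) (auto simp: A_def Q_def)
    qed (use abs_\<phi>_le q_ge_2 in auto)
    finally show ?thesis .
  qed
  have "(\<Sum>n\<in>T. \<phi> r n) = (\<Sum>u\<in>A. \<Sum>n | n \<in> T \<and> n mod Q = u. \<phi> r n)"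
  proof (rule sum.group[symmetric])
    show "(\<lambda>n. n mod Q) ` T \<subseteq> A"
    proof
      fix u assume "u \<in> (\<lambda>n. n mod Q) ` T"
      then obtain n where "n \<in> T" "u = n mod Q" by auto
      then show "u \<in> A" using lev[of u "n div Q"] Q by (auto simp: T_def)
    qed
  qed (use finA in \<open>auto simp: T_def\<close>)
  also have "\<bar>\<dots>\<bar> \<le> (\<Sum>u\<in>A. \<bar>\<Sum>n | n \<in> T \<and> n mod Q = u. \<phi> r n\<bar>)" by (rule sum_abs)
  also have "\<dots> \<le> real (card A) * (2 * real q * real q)"
    by (rule sum_bounded_above) (rule fibre)
  also have "\<dots> \<le> real (q * r) * (2 * real q * real q)"
    using cardA by (intro mult_right_mono) (auto simp only: of_nat_le_iff, simp)
  finally show ?thesis by (simp add: T_def)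
qed

text \<open>Adding \<open>q ^ Suc e\<close> or more always changes the quotient by
  \<open>q ^ Suc e\<close>, so the small levels are empty.\<close>

lemma not_level:
  assumes "q ^ Suc e \<le> r"
  shows "\<not> level r e n"
proof -
  have "n div q ^ Suc e < (n + q ^ Suc e) div q ^ Suc e" using q_ge_2 by simp
  also have "\<dots> \<le> (n + r) div q ^ Suc e" using assms by (intro div_le_mono) simp
  finally show ?thesis by (simp add: level_def)
qed

text \<open>Raising \<open>E\<close> by one moves exactly level \<open>E\<close> out of the
  remainder, since differing quotients by \<open>q ^ Suc E\<close> come from differing quotients by
  \<open>q ^ E\<close>. At \<open>E = 0\<close> the remainder is everything because
  \<open>r \<ge> 1\<close>.\<close>

lemma sum_\<phi>_telescope:
  assumes "r \<ge> 1"
  shows "(\<Sum>n<N. \<phi> r n) = (\<Sum>e<E. \<Sum>n | n < N \<and> level r e n. \<phi> r n)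
    + (\<Sum>n | n < N \<and> n div q ^ E \<noteq> (n + r) div q ^ E. \<phi> r n)"
proof (induction E)
  case 0
  have "{n. n < N \<and> n div q ^ 0 \<noteq> (n + r) div q ^ 0} = {..<N}" using assms by auto
  then show ?case by simp
next
  case (Suc E)
  have imp: "n div q ^ E \<noteq> (n + r) div q ^ E"
    if "n div q ^ Suc E \<noteq> (n + r) div q ^ Suc E" for n
    using that unfolding power_Suc2 div_mult2_eq by auto
  have "{n. n < N \<and> n div q ^ E \<noteq> (n + r) div q ^ E}
      = {n. n < N \<and> level r E n} \<union> {n. n < N \<and> n div q ^ Suc E \<noteq> (n + r) div q ^ Suc E}"
    using imp unfolding level_def by blast
  moreover have "(\<Sum>n\<in>{n. n < N \<and> level r E n} \<union> {n. n < N \<and> n div q ^ Suc E \<noteq> (n + r) div q ^ Suc E}. \<phi> r n)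
      = (\<Sum>n | n < N \<and> level r E n. \<phi> r n)
        + (\<Sum>n | n < N \<and> n div q ^ Suc E \<noteq> (n + r) div q ^ Suc E. \<phi> r n)"
    by (rule sum.union_disjoint) (auto simp only: finite_Collect_conjI finite_Collect_less_nat level_def)
  ultimately show ?case using Suc by simp
qed

lemma abs_sum_\<phi>_le_card: "\<bar>\<Sum>n\<in>S. \<phi> r n\<bar> \<le> real (card S) * real q"
  using sum_abs[of "\<phi> r" S] sum_bounded_above[of S "\<lambda>n. \<bar>\<phi> r n\<bar>" "real q"] abs_\<phi>_le
  by (meson order_trans)

lemma abs_sum_\<phi>_le:
  assumes r: "r \<ge> 1"
  shows "\<bar>\<Sum>n<N. \<phi> r n\<bar>
    \<le> real q * real r * (1 + 4 * (real q)\<^sup>2 + 4 * (real q)\<^sup>2 * max 0 (ln (real N / real r)))"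
proof -
  \<comment> \<open>The least \<open>E\<close> serves twice: \<open>N \<le> q ^ E\<close> makes the
    remainder small, and minimality yields \<open>q ^ e < N\<close> for the levels that are
    counted.\<close>
  define E where "E = (LEAST E. N \<le> q ^ E)"
  have "N < q ^ N" using q_ge_2 by (intro power_gt_expt) auto
  then have E: "N \<le> q ^ E" unfolding E_def using LeastI[of "\<lambda>E. N \<le> q ^ E" N] by simp
  have minimal: "q ^ e < N" if "e < E" for e
    using not_less_Least[of e "\<lambda>E. N \<le> q ^ E"] that by (simp add: E_def)
  define B where "B e = (\<Sum>n | n < N \<and> level r e n. \<phi> r n)" for e
  define I where "I = {e. e < E \<and> r < q ^ Suc e}"
  define L where "L = max 0 (ln (real N / real r))"
  have "(\<Sum>e<E. B e) = (\<Sum>e\<in>I. B e)"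
  proof (rule sum.mono_neutral_right)
    show "\<forall>e\<in>{..<E} - I. B e = 0"
    proof
      fix e assume "e \<in> {..<E} - I"
      then have "\<not> level r e n" for n by (intro not_level) (auto simp: I_def)
      then show "B e = 0" by (simp add: B_def)
    qed
  qed (auto simp: I_def)
  also have "\<bar>\<dots>\<bar> \<le> (\<Sum>e\<in>I. \<bar>B e\<bar>)" by (rule sum_abs)
  also have "\<dots> \<le> real (card I) * (real (q * r) * (2 * real q * real q))"
    by (rule sum_bounded_above) (simp only: B_def level_sum_le)
  also have "\<dots> \<le> (2 + 2 * L) * (real (q * r) * (2 * real q * real q))"
    unfolding I_def L_def
    by (intro mult_right_mono card_level_set_le q_ge_2 r minimal) auto
  finally have main: "\<bar>\<Sum>e<E. B e\<bar> \<le> (2 + 2 * L) * (real (q * r) * (2 * real q * real q))" .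
  define S where "S = {n. n < N \<and> n div q ^ E \<noteq> (n + r) div q ^ E}"
  \<comment> \<open>As \<open>n < N \<le> q ^ E\<close>, \<open>n\<close> is its own residue, so a
    carry forces it into the last \<open>r\<close> places below \<open>q ^ E\<close>.\<close>
  have "S \<subseteq> {q ^ E - r..<q ^ E}"
  proof
    fix n assume "n \<in> S"
    then show "n \<in> {q ^ E - r..<q ^ E}"
      using mod_ge_if_div_add_neq[of n "q ^ E" r] E q_ge_2 by (auto simp: S_def)
  qed
  then have "card S \<le> r" using card_mono[of "{q ^ E - r..<q ^ E}" S] by simp
  then have "real (card S) * real q \<le> real r * real q" by (intro mult_right_mono) auto
  then have "\<bar>\<Sum>n\<in>S. \<phi> r n\<bar> \<le> real r * real q"
    using abs_sum_\<phi>_le_card[of r S] by linarith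
  with main have "\<bar>\<Sum>n<N. \<phi> r n\<bar> \<le> (2 + 2 * L) * (real (q * r) * (2 * real q * real q)) + real r * real q"
    using sum_\<phi>_telescope[OF r, of N E] unfolding B_def S_def by linarith
  then show ?thesis by (simp add: L_def algebra_simps power2_eq_square)
qed

text \<open>Shifting the window by \<open>r1\<close> reduces to lag \<open>r2 - r1\<close> at the
  cost of at most \<open>2 * r1\<close> boundary terms; these and the terms without a logarithm make
  up the error \<open>r2\<close>.\<close>

lemma sum_\<delta>_estimate:
  assumes r: "r1 < r2"
  shows "\<bar>real (\<Sum>n<N. \<delta> a (n + r1) (n + r2)) - real N * (1 - 1 / real q)\<bar>
    \<le> (4 * (real q)\<^sup>2 + 2) * (real (r2 - r1) * max 0 (ln (real N / real (r2 - r1))) + real r2)"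
proof -
  define r where "r = r2 - r1"
  define L where "L = max 0 (ln (real N / real r))"
  have r2: "r2 = r1 + r" and r1: "r \<ge> 1" using r by (auto simp: r_def)
  have q: "real q > 0" using q_ge_2 by simp
  have "real (\<delta> a (n + r1) (n + r2)) = 1 - 1 / real q - \<phi> r (n + r1) / real q" for n
    using q by (simp add: \<delta>_def \<phi>_def r2 add.assoc field_simps)
  then have "real (\<Sum>n<N. \<delta> a (n + r1) (n + r2)) - real N * (1 - 1 / real q)
      = - ((\<Sum>n<N. \<phi> r (n + r1)) / real q)"
    by (simp add: sum_subtractf sum_divide_distrib)
  also have "(\<Sum>n<N. \<phi> r (n + r1)) = (\<Sum>n<N. \<phi> r n) + (\<Sum>n=N..<N + r1. \<phi> r n) - (\<Sum>n<r1. \<phi> r n)"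
    using sum.shift_bounds_nat_ivl[of "\<phi> r" 0 r1 N]
      sum.atLeastLessThan_concat[of 0 r1 "N + r1" "\<phi> r"]
      sum.atLeastLessThan_concat[of 0 N "N + r1" "\<phi> r"]
    by (simp add: lessThan_atLeast0)
  finally have eq: "\<bar>real (\<Sum>n<N. \<delta> a (n + r1) (n + r2)) - real N * (1 - 1 / real q)\<bar>
      = \<bar>(\<Sum>n<N. \<phi> r n) + (\<Sum>n=N..<N + r1. \<phi> r n) - (\<Sum>n<r1. \<phi> r n)\<bar> / real q"
    by simp
  have "\<bar>(\<Sum>n<N. \<phi> r n) + (\<Sum>n=N..<N + r1. \<phi> r n) - (\<Sum>n<r1. \<phi> r n)\<bar>
      \<le> real q * real r * (1 + 4 * (real q)\<^sup>2 + 4 * (real q)\<^sup>2 * L) + 2 * (real r1 * real q)"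
    using abs_sum_\<phi>_le[OF r1, of N] abs_sum_\<phi>_le_card[of r "{N..<N + r1}"]
      abs_sum_\<phi>_le_card[of r "{..<r1}"] unfolding L_def by simp
  also have "\<dots> = real q * (real r * (1 + 4 * (real q)\<^sup>2 + 4 * (real q)\<^sup>2 * L) + 2 * real r1)"
    by (simp add: algebra_simps)
  finally have "\<bar>real (\<Sum>n<N. \<delta> a (n + r1) (n + r2)) - real N * (1 - 1 / real q)\<bar>
      \<le> real r * (1 + 4 * (real q)\<^sup>2 + 4 * (real q)\<^sup>2 * L) + 2 * real r1"
    unfolding eq using q by (simp add: pos_divide_le_eq mult.commute)
  \<comment> \<open>Since \<open>r2 = r1 + r\<close>, the term \<open>r2\<close> absorbs both the
    boundary loss and the part linear in \<open>r\<close>.\<close>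
  also have "\<dots> \<le> (4 * (real q)\<^sup>2 + 2) * (real r * L + real r2)"
  proof -
    have "0 \<le> real r * L" "0 \<le> (real q)\<^sup>2 * real r1" by (auto simp: L_def)
    then show ?thesis by (simp add: r2 algebra_simps)
  qed
  finally show ?thesis by (simp add: L_def r_def)
qed

end

section \<open>Specialisation to \<open>Zp_power p k\<close>\<close>

lemma comm_group_Zp_power: "comm_group (Zp_power p k)"
  unfolding Zp_power_def
  by (intro group.group_comm_groupI product_group) (auto simp: add.commute)

lemma carrier_Zp_power:
  assumes "p > 0"
  shows "carrier (Zp_power p k) = (\<Pi>\<^sub>E i\<in>{..<k}. {0..<int p})"
  using assms by (simp add: Zp_power_def carrier_integer_mod_group)

text \<open>The bound is uniform in \<open>N\<close>, so no limit occurs. The \<open>max 0\<close>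
  treats \<open>N < r2 - r1\<close>, where the logarithm is negative.\<close>

theorem theorem4:
  fixes p k :: nat
  assumes "prime p" and "k \<ge> 1"
  shows "\<exists>C::real. C > 0 \<and>
    (\<forall>M a. M \<in> difference_matrices (p ^ k) (p ^ k) (Zp_power p k) \<longrightarrow>
       rudin_shapiro_seq p k M a \<longrightarrow>
       (\<forall>r1 r2 N :: nat. r1 < r2 \<longrightarrow> N \<ge> 1 \<longrightarrow>
          \<bar>real (\<Sum>n<N. \<delta> a (n + r1) (n + r2)) - real N * (1 - 1 / real (p ^ k))\<bar>
            \<le> C * (real (r2 - r1) * max 0 (ln (real N / real (r2 - r1))) + real r2)))"
proof (intro exI[of _ "4 * (real (p ^ k))\<^sup>2 + 2"] conjI allI impI)
  show "0 < 4 * (real (p ^ k))\<^sup>2 + 2" by (simp add: add_nonneg_pos)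
next
  fix M a and r1 r2 N :: nat
  assume M: "M \<in> difference_matrices (p ^ k) (p ^ k) (Zp_power p k)"
    and a: "rudin_shapiro_seq p k M a" and r: "r1 < r2"
  have p: "p \<ge> 2" using assms(1) by (rule prime_ge_2_nat)
  have "p \<le> p ^ k" using assms(2) p by (intro self_le_power) auto
  interpret comm_group "Zp_power p k" by (rule comm_group_Zp_power)
  interpret difference_matrix_sequence "Zp_power p k" "p ^ k" M a
  proof
    show "finite (carrier (Zp_power p k))" "card (carrier (Zp_power p k)) = p ^ k"
      using p by (auto simp: carrier_Zp_power card_PiE intro!: finite_PiE)
    show "2 \<le> p ^ k" using \<open>p \<le> p ^ k\<close> p by simp
    show "M \<in> difference_matrices (p ^ k) (p ^ k) (Zp_power p k)" by (rule M)
    show "a n \<in> carrier (Zp_power p k)" for n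
      using a by (simp add: rudin_shapiro_seq_def)
    show "a (p ^ k * n + j) = a n \<otimes>\<^bsub>Zp_power p k\<^esub> M (n mod p ^ k) j"
      if j: "j < p ^ k" and "(j, n) \<noteq> (0, 0)" for n j
    proof -
      \<comment> \<open>\<open>j < p ^ k\<close> makes the reduction of the column index trivial;
        only the row index stays reduced.\<close>
      have "rs_g (p ^ k) M (int j) (int n) = M (n mod p ^ k) j"
        using j unfolding rs_g_def by (simp only: nat_int flip: zmod_int) simp
      then show ?thesis using a that by (simp only: rudin_shapiro_seq_def) metis
    qed
  qed
  show "\<bar>real (\<Sum>n<N. \<delta> a (n + r1) (n + r2)) - real N * (1 - 1 / real (p ^ k))\<bar>
      \<le> (4 * (real (p ^ k))\<^sup>2 + 2)
        * (real (r2 - r1) * max 0 (ln (real N / real (r2 - r1))) + real r2)"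
    by (rule sum_\<delta>_estimate[OF r])
qed

end
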